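(* Consider a finite discounted MDP with $\mathcal S_{\mathrm{sep}}\neq\varnothing$ and its Q-value iteration $Q_{k+1}=F(Q_k)$ started from $Q_0\in\mathbb R^n$. Fix any $\varepsilon>0$ such that $\beta_\varepsilon:=\bar\rho+\varepsilon\in(0,1)$, and let $c_\varepsilon>0$ be a constant such that every Q-value iteration trajectory satisfies $\operatorname{dist}_2(Q_k,\mathcal X_1)\le c_\varepsilon\beta_\varepsilon^k\operatorname{dist}_2(Q_0,\mathcal X_1)$ for all $k\ge0$ (such a constant exists). Define $$K_{\mathrm{id}}:=\begin{cases}0,& c_\varepsilon\operatorname{dist}_2(Q_0,\mathcal X_1)<\bar\Delta/2,\\[1ex] \left\lfloor\dfrac{\log\left(2c_\varepsilon\operatorname{dist}_2(Q_0,\mathcal X_1)/\bar\Delta\right)}{-\log\beta_\varepsilon}\right\rfloor+1,& c_\varepsilon\operatorname{dist}_2(Q_0,\mathcal X_1)\ge\bar\Delta/2.\end{cases}$$ Then $Q_k\in\mathcal X^*$ for all $k\ge K_{\mathrm{id}}$. In particular, $\pi_{Q_k}(s)\in\Phi^*(s)$ for all $s\in\mathcal S$ and all $k\ge K_{\mathrm{id}}$.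
   Context: Finite discounted MDP: finite nonempty state set $\mathcal S$ and action set $\mathcal A$, transition probabilities $P(s'|s,a)$, expected one-step rewards $R(s,a)\in\mathbb R$, discount $\gamma\in(0,1)$. Put $n=|\mathcal S||\mathcal A|$ and identify functions $Q:\mathcal S\times\mathcal A\to\mathbb R$ with vectors in $\mathbb R^n$. $P$ also denotes the $n\times|\mathcal S|$ matrix with entry $P(s'|s,a)$ in row $(s,a)$, column $s'$. For a deterministic policy $\pi:\mathcal S\to\mathcal A$, $\Pi^\pi$ is the $|\mathcal S|\times n$ matrix with $(\Pi^\pi Q)(s)=Q(s,\pi(s))$. $\Theta$ is the (finite) set of all deterministic policies. Bellman operator: $(FQ)(s,a)=R(s,a)+\gamma\sum_{s'}P(s'|s,a)\max_{a'}Q(s',a')$. $Q^*$ is the optimal Q-function, $Q^*(s,a)=\max_{\pi\in\Theta}Q^\pi(s,a)$, the unique fixed point of $F$; $V^*(s)=\max_aQ^*(s,a)$. Q-value iteration: $Q_{k+1}=F(Q_k)$, $k\ge0$. $\pi_Q(s)$ is a greedy action of $Q$ at $s$, i.e. the element of $\operatorname{Arg\,max}_aQ(s,a)$ selected by a fixed tie-breaking rule. $\Phi^*(s):=\operatorname{Arg\,max}_{a\in\mathcal A}Q^*(s,a)$ (a set). Practically optimal solution set: $\mathcal X^*:=\{Q\in\mathbb R^n:\pi_Q(s)\in\Phi^*(s)\ \forall s\in\mathcal S\}$. $\mathcal S_{\mathrm{sep}}:=\{s:\Phi^*(s)\ne\mathcal A\}$; for $s\in\mathcal S_{\mathrm{sep}}$,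 $\bar\Delta_s:=V^*(s)-\max_{a\notin\Phi^*(s)}Q^*(s,a)$; $\bar\Delta:=\min_{s\in\mathcal S_{\mathrm{sep}}}\bar\Delta_s>0$. $\mathbf 1\in\mathbb R^n$ is the all-ones vector, $\mathcal X_1:=Q^*+\operatorname{span}(\mathbf 1)$, $\operatorname{dist}_2$ is Euclidean distance to a set. $\mathbf\Pi_\perp:=I-\frac1n\mathbf 1\mathbf 1^\top$, $A_\pi:=\gamma P\Pi^\pi$, $\bar A_\pi:=\mathbf\Pi_\perp A_\pi\mathbf\Pi_\perp$, and $\bar\rho$ is the joint spectral radius of $\{\bar A_\pi:\pi\in\Theta\}$, where for a finite set of matrices $\rho(M_1,\dots,M_m)=\lim_{k\to\infty}\max_{\sigma\in\{1,\dots,m\}^k}\|M_{\sigma_k}\cdots M_{\sigma_1}\|^{1/k}$ (any submultiplicative norm). *)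

theory Defs
  imports "HOL-Analysis.Analysis"
begin

text \<open>
  States and actions are the (finite, nonempty) types \<open>'s\<close> and \<open>'a\<close>; functions on state-action
  pairs are vectors indexed by \<open>'s \<times> 'a\<close>. \<open>P $ (s, a) $ s'\<close> is the probability of moving
  to \<open>s'\<close> from \<open>s\<close> under \<open>a\<close>, and \<open>R $ (s, a)\<close> is the expected one-step reward. A deterministic
  policy is an arbitrary function \<open>'s \<Rightarrow> 'a\<close>.
\<close>

definition discounted_mdp :: "real ^ 's ^ ('s::finite \<times> 'a::finite) \<Rightarrow> real \<Rightarrow> bool" where
  "discounted_mdp P \<gamma> \<longleftrightarrow>
     (\<forall>sa s'. 0 \<le> P $ sa $ s') \<and> (\<forall>sa. (\<Sum>s'\<in>UNIV. P $ sa $ s') = 1) \<and> 0 < \<gamma> \<and> \<gamma> < 1"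

definition bellman ::
  "real ^ 's ^ ('s::finite \<times> 'a::finite) \<Rightarrow> real ^ ('s \<times> 'a) \<Rightarrow> real \<Rightarrow>
   real ^ ('s \<times> 'a) \<Rightarrow> real ^ ('s \<times> 'a)" where
  "bellman P R \<gamma> Q =
     (\<chi> sa. R $ sa + \<gamma> * (\<Sum>s'\<in>UNIV. P $ sa $ s' * (MAX a'. Q $ (s', a'))))"

definition q_iter ::
  "real ^ 's ^ ('s::finite \<times> 'a::finite) \<Rightarrow> real ^ ('s \<times> 'a) \<Rightarrow> real \<Rightarrow>
   real ^ ('s \<times> 'a) \<Rightarrow> nat \<Rightarrow> real ^ ('s \<times> 'a)" where
  "q_iter P R \<gamma> Q0 k = (bellman P R \<gamma> ^^ k) Q0"

definition policy_matrix :: "('s::finite \<Rightarrow> 'a::finite) \<Rightarrow> real ^ ('s \<times> 'a) ^ 's" where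
  "policy_matrix \<pi> = (\<chi> s sa. if sa = (s, \<pi> s) then 1 else 0)"

text \<open>
  \<open>P ** policy_matrix \<pi>\<close> is the transition matrix of the Markov chain of state-action pairs
  under \<open>\<pi>\<close>, so its \<open>k\<close>-th power applied to \<open>R\<close> is the expected reward at time \<open>k\<close> as a
  function of the initial pair. Hence \<open>policy_Q\<close> is the expected discounted return of
  playing \<open>a\<close> in \<open>s\<close> and following \<open>\<pi>\<close> from then on.
\<close>

definition policy_Q ::
  "real ^ 's ^ ('s::finite \<times> 'a::finite) \<Rightarrow> real ^ ('s \<times> 'a) \<Rightarrow> real \<Rightarrow>
   ('s \<Rightarrow> 'a) \<Rightarrow> real ^ ('s \<times> 'a)" where
  "policy_Q P R \<gamma> \<pi> =
     (\<chi> sa. \<Sum>k. \<gamma> ^ k * (((\<lambda>x. (P ** policy_matrix \<pi>) *v x) ^^ k) R) $ sa)"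

definition opt_Q ::
  "real ^ 's ^ ('s::finite \<times> 'a::finite) \<Rightarrow> real ^ ('s \<times> 'a) \<Rightarrow> real \<Rightarrow> real ^ ('s \<times> 'a)" where
  "opt_Q P R \<gamma> = (\<chi> sa. MAX \<pi>. policy_Q P R \<gamma> \<pi> $ sa)"

definition opt_V ::
  "real ^ 's ^ ('s::finite \<times> 'a::finite) \<Rightarrow> real ^ ('s \<times> 'a) \<Rightarrow> real \<Rightarrow> 's \<Rightarrow> real" where
  "opt_V P R \<gamma> s = (MAX a. opt_Q P R \<gamma> $ (s, a))"

definition argmax_actions :: "real ^ ('s::finite \<times> 'a::finite) \<Rightarrow> 's \<Rightarrow> 'a set" where
  "argmax_actions Q s = {a. \<forall>b. Q $ (s, b) \<le> Q $ (s, a)}"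

text \<open>
  A tie-breaking rule selects one element from every nonempty set of maximizing actions;
  it may depend on the state.
\<close>

definition tie_breaking :: "('s \<Rightarrow> 'a set \<Rightarrow> 'a) \<Rightarrow> bool" where
  "tie_breaking tb \<longleftrightarrow> (\<forall>s B. B \<noteq> {} \<longrightarrow> tb s B \<in> B)"

definition greedy ::
  "('s \<Rightarrow> 'a set \<Rightarrow> 'a) \<Rightarrow> real ^ ('s::finite \<times> 'a::finite) \<Rightarrow> 's \<Rightarrow> 'a" where
  "greedy tb Q s = tb s (argmax_actions Q s)"

definition opt_actions ::
  "real ^ 's ^ ('s::finite \<times> 'a::finite) \<Rightarrow> real ^ ('s \<times> 'a) \<Rightarrow> real \<Rightarrow> 's \<Rightarrow> 'a set" where
  "opt_actions P R \<gamma> s = argmax_actions (opt_Q P R \<gamma>) s"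

definition practically_optimal ::
  "('s \<Rightarrow> 'a set \<Rightarrow> 'a) \<Rightarrow> real ^ 's ^ ('s::finite \<times> 'a::finite) \<Rightarrow> real ^ ('s \<times> 'a) \<Rightarrow> real \<Rightarrow>
   (real ^ ('s \<times> 'a)) set" where
  "practically_optimal tb P R \<gamma> = {Q. \<forall>s. greedy tb Q s \<in> opt_actions P R \<gamma> s}"

definition sep_states ::
  "real ^ 's ^ ('s::finite \<times> 'a::finite) \<Rightarrow> real ^ ('s \<times> 'a) \<Rightarrow> real \<Rightarrow> 's set" where
  "sep_states P R \<gamma> = {s. opt_actions P R \<gamma> s \<noteq> UNIV}"

definition state_gap ::
  "real ^ 's ^ ('s::finite \<times> 'a::finite) \<Rightarrow> real ^ ('s \<times> 'a) \<Rightarrow> real \<Rightarrow> 's \<Rightarrow> real" where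
  "state_gap P R \<gamma> s =
     opt_V P R \<gamma> s - (MAX a\<in>- opt_actions P R \<gamma> s. opt_Q P R \<gamma> $ (s, a))"

definition gap ::
  "real ^ 's ^ ('s::finite \<times> 'a::finite) \<Rightarrow> real ^ ('s \<times> 'a) \<Rightarrow> real \<Rightarrow> real" where
  "gap P R \<gamma> = (MIN s\<in>sep_states P R \<gamma>. state_gap P R \<gamma> s)"

text \<open>The affine line \<open>Q\<^sup>* + span {1}\<close>, where \<open>1\<close> is the all-ones vector.\<close>

definition opt_line ::
  "real ^ 's ^ ('s::finite \<times> 'a::finite) \<Rightarrow> real ^ ('s \<times> 'a) \<Rightarrow> real \<Rightarrow>
   (real ^ ('s \<times> 'a)) set" where
  "opt_line P R \<gamma> = (\<lambda>x. opt_Q P R \<gamma> + x) ` span {1}"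

definition centering_matrix :: "real ^ 'n ^ ('n::finite)" where
  "centering_matrix = mat 1 - (1 / real CARD('n)) *\<^sub>R (\<chi> i j. 1)"

definition projected_policy_matrix ::
  "real ^ 's ^ ('s::finite \<times> 'a::finite) \<Rightarrow> real \<Rightarrow> ('s \<Rightarrow> 'a) \<Rightarrow>
   real ^ ('s \<times> 'a) ^ ('s \<times> 'a)" where
  "projected_policy_matrix P \<gamma> \<pi> =
     centering_matrix ** (\<gamma> *\<^sub>R (P ** policy_matrix \<pi>)) ** centering_matrix"

text \<open>
  Intended for finite nonempty \<open>\<M>\<close>. The norm is the operator norm induced by the Euclidean norm.
  For a word \<open>[M\<^sub>1, \<dots>, M\<^sub>k]\<close> the fold is \<open>M\<^sub>k ** \<dots> ** M\<^sub>1\<close>.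
\<close>

definition joint_spectral_radius :: "(real ^ 'n ^ 'n::finite) set \<Rightarrow> real" where
  "joint_spectral_radius \<M> =
     lim (\<lambda>k. MAX w\<in>{w. length w = k \<and> set w \<subseteq> \<M>}.
                root k (onorm (\<lambda>x. fold (**) w (mat 1) *v x)))"

definition rho_bar :: "real ^ 's ^ ('s::finite \<times> 'a::finite) \<Rightarrow> real \<Rightarrow> real" where
  "rho_bar P \<gamma> = joint_spectral_radius (range (projected_policy_matrix P \<gamma>))"

definition trajectory_bound ::
  "real ^ 's ^ ('s::finite \<times> 'a::finite) \<Rightarrow> real ^ ('s \<times> 'a) \<Rightarrow> real \<Rightarrow> real \<Rightarrow> real \<Rightarrow> bool" where
  "trajectory_bound P R \<gamma> \<beta> c \<longleftrightarrow>
     (\<forall>Q0 k. infdist (q_iter P R \<gamma> Q0 k) (opt_line P R \<gamma>)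
               \<le> c * \<beta> ^ k * infdist Q0 (opt_line P R \<gamma>))"

text \<open>
  In the second case the argument of \<open>ln\<close> is at least 1, so for \<open>0 < \<beta> < 1\<close> the floor is
  nonnegative and \<open>nat\<close> does not truncate.
\<close>

definition K_id ::
  "real ^ 's ^ ('s::finite \<times> 'a::finite) \<Rightarrow> real ^ ('s \<times> 'a) \<Rightarrow> real \<Rightarrow> real \<Rightarrow> real \<Rightarrow>
   real ^ ('s \<times> 'a) \<Rightarrow> nat" where
  "K_id P R \<gamma> \<beta> c Q0 =
     (if c * infdist Q0 (opt_line P R \<gamma>) < gap P R \<gamma> / 2 then 0
      else nat \<lfloor>ln (2 * c * infdist Q0 (opt_line P R \<gamma>) / gap P R \<gamma>) / (- ln \<beta>)\<rfloor> + 1)"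

end

theory Submission
  imports Defs
begin

text \<open>
  Modulo constants, the error \<open>Q\<^sub>k - Q\<^sup>*\<close> evolves by statewise mixtures of the projected policy
  matrices. By convexity, its image under a product of such matrices has norm at most the norm
  obtained when each mixture is replaced by a suitable deterministic policy, so the error decays
  at any rate above the joint spectral radius. Once \<open>Q\<^sub>k\<close> is within half the gap of the line
  \<open>Q\<^sup>* + span {1}\<close>, no suboptimal action can overtake an optimal one, since shifting by a
  constant does not affect the order of the entries.
\<close>

section \<open>Roots of submultiplicative sequences\<close>

text \<open>Every exponent splits into blocks of length \<open>n\<close> and a remainder below
  \<open>n\<close>. Each block costs at most a factor \<open>b ^ n\<close>, and the finitely many
  remainders are absorbed in \<open>c\<close>.\<close>

lemma submultiplicative_le_geometric:
  fixes m :: "nat \<Rightarrow> real"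
  assumes nonneg: "\<And>k. 0 \<le> m k" and submult: "\<And>j k. m (j + k) \<le> m j * m k"
    and n: "0 < n" "root n (m n) < b"
  obtains c where "c > 0" "\<And>k. m k \<le> c * b ^ k"
proof -
  have b: "0 < b"
    using n nonneg[of n] by (meson le_less_trans real_root_ge_zero)
  have mn: "m n \<le> b ^ n"
    using n nonneg[of n] b
    by (metis less_eq_real_def power_mono real_root_ge_zero real_root_pow_pos2)
  \<comment> \<open>The sum dominates each \<open>m r / b ^ r\<close> with \<open>r < n\<close>. The
    summand 1 keeps \<open>c\<close> positive even if all of these vanish.\<close>
  define c where "c = 1 + (\<Sum>r<n. m r / b ^ r)"
  have c: "c > 0"
    unfolding c_def using nonneg b by (intro add_pos_nonneg sum_nonneg) auto
  have "m k \<le> c * b ^ k" for k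
  proof (induction k rule: less_induct)
    case (less k)
    show ?case
    proof (cases "k < n")
      case True
      then have "m k / b ^ k \<le> (\<Sum>r<n. m r / b ^ r)"
        using nonneg b by (intro member_le_sum) auto
      then have "m k / b ^ k \<le> c"
        unfolding c_def by simp
      then show ?thesis
        using b by (simp add: field_simps)
    next
      case False
      then have "m k \<le> m n * m (k - n)"
        using submult[of n "k - n"] by simp
      also have "\<dots> \<le> b ^ n * (c * b ^ (k - n))"
        using False n less.IH[of "k - n"] mn nonneg b by (intro mult_mono) auto
      also have "\<dots> = c * b ^ k"
        using False by (simp add: power_add[symmetric])
      finally show ?thesis .
    qed
  qed
  with c show ?thesis
    using that by blast
qed

text \<open>Fekete's lemma in multiplicative form: the limit is the infimum of the roots.
  Convergence matters because \<open>joint_spectral_radius\<close> is defined through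
  \<open>lim\<close>.\<close>

lemma submultiplicative_root_convergent:
  fixes m :: "nat \<Rightarrow> real"
  assumes nonneg: "\<And>k. 0 \<le> m k" and submult: "\<And>j k. m (j + k) \<le> m j * m k"
  shows "convergent (\<lambda>k. root k (m k))"
proof -
  \<comment> \<open>Index 0 is left out because \<open>root 0\<close> is 0 by convention.\<close>
  define L where "L = (INF k\<in>{0<..}. root k (m k))"
  have bdd: "bdd_below ((\<lambda>k. root k (m k)) ` {0<..})"
    using nonneg by (intro bdd_belowI2[of _ 0]) auto
  have "(\<lambda>k. root k (m k)) \<longlonglongrightarrow> L"
  proof (rule order_tendstoI)
    fix a assume "a < L"
    moreover have "L \<le> root k (m k)" if "k > 0" for k
      unfolding L_def using bdd that by (intro cINF_lower) auto
    ultimately have "a < root k (m k)" if "k > 0" for k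
      using that less_le_trans by blast
    then show "\<forall>\<^sub>F k in sequentially. a < root k (m k)"
      by (rule eventually_mono[OF eventually_gt_at_top])
  next
    fix b assume "L < b"
    \<comment> \<open>The room between \<open>b'\<close> and \<open>b\<close> absorbs the factor
      \<open>root k c\<close>, which tends to 1.\<close>
    then obtain b' where b': "L < b'" "b' < b"
      using dense by blast
    then obtain n where n: "n > 0" "root n (m n) < b'"
      unfolding L_def using bdd by (subst (asm) cINF_less_iff) auto
    have b'0: "0 < b'"
      using n nonneg[of n] by (meson le_less_trans real_root_ge_zero)
    obtain c where c: "c > 0" "\<And>k. m k \<le> c * b' ^ k"
      using submultiplicative_le_geometric[of m n b'] nonneg submult n by metis
    have "(\<lambda>k. root k c * b') \<longlonglongrightarrow> 1 * b'"
      by (intro tendsto_intros LIMSEQ_root_const c)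
    then have "\<forall>\<^sub>F k in sequentially. root k c * b' < b"
      using b' by (intro order_tendstoD) auto
    then show "\<forall>\<^sub>F k in sequentially. root k (m k) < b"
      using eventually_gt_at_top[of 0]
    proof eventually_elim
      case (elim k)
      have "root k (m k) \<le> root k (c * b' ^ k)"
        using c elim by (intro real_root_le_mono) auto
      also have "\<dots> = root k c * b'"
        using elim b'0 by (simp add: real_root_mult real_root_power_cancel)
      finally show ?case
        using elim by simp
    qed
  qed
  then show ?thesis
    by (rule convergentI)
qed

section \<open>Products of matrices from a finite set\<close>

lemma fold_matrix_mult_append:
  fixes w v :: "(real ^ 'n ^ 'n::finite) list"
  shows "fold (**) (w @ v) (mat 1) = fold (**) v (mat 1) ** fold (**) w (mat 1)"
proof (induction v rule: rev_induct)
  case (snoc M v)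
  then show ?case by (simp add: matrix_mul_assoc)
qed simp

text \<open>Cutting words in two shows that the maximal norms over words of length \<open>k\<close>
  are submultiplicative. The defining limit therefore exists, and a single length whose root lies
  below \<open>b\<close> gives a geometric bound for all lengths.\<close>

lemma joint_spectral_radius_bound:
  fixes \<M> :: "(real ^ 'n ^ 'n::finite) set"
  assumes "finite \<M>" "\<M> \<noteq> {}" "joint_spectral_radius \<M> < b"
  obtains c where "c > 0"
    "\<And>w x. set w \<subseteq> \<M> \<Longrightarrow> norm (fold (**) w (mat 1) *v x) \<le> c * b ^ length w * norm x"
proof -
  define W where "W k = {w. length w = k \<and> set w \<subseteq> \<M>}" for k
  define h where "h w = onorm (\<lambda>x. fold (**) w (mat 1) *v x)" for w :: "(real^'n^'n) list"
  define m where "m k = (MAX w\<in>W k. h w)" for k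
  have finW: "finite (W k)" for k
    using finite_lists_length_eq[OF assms(1), of k] by (simp add: W_def conj_commute)
  have neW: "W k \<noteq> {}" for k
  proof -
    obtain M where "M \<in> \<M>" using assms(2) by blast
    then have "replicate k M \<in> W k" by (auto simp: W_def)
    then show ?thesis by blast
  qed
  have h0: "0 \<le> h w" for w
    unfolding h_def by (intro onorm_pos_le matrix_vector_mul_bounded_linear)
  have hm: "h w \<le> m (length w)" if "set w \<subseteq> \<M>" for w
    unfolding m_def using finW that by (intro Max_ge) (auto simp: W_def)
  have m0: "0 \<le> m k" for k
    using neW[of k] h0 hm by (force simp: W_def intro: order_trans)
  have happ: "h (w @ v) \<le> h v * h w" for w v
  proof -
    have "h (w @ v) = onorm ((\<lambda>x. fold (**) v (mat 1) *v x) \<circ> (\<lambda>x. fold (**) w (mat 1) *v x))"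
      unfolding h_def fold_matrix_mult_append
      by (simp add: o_def matrix_vector_mul_assoc)
    also have "\<dots> \<le> h v * h w"
      unfolding h_def by (intro onorm_compose matrix_vector_mul_bounded_linear)
    finally show ?thesis .
  qed
  have mm: "m (j + k) \<le> m j * m k" for j k
    unfolding m_def[of "j + k"]
  proof (rule Max.boundedI)
    show "finite (h ` W (j + k))" "h ` W (j + k) \<noteq> {}"
      using finW neW by auto
    fix y assume "y \<in> h ` W (j + k)"
    then obtain w where w: "length w = j + k" "set w \<subseteq> \<M>" "y = h w"
      by (auto simp: W_def)
    have 1: "set (take j w) \<subseteq> \<M>" "set (drop j w) \<subseteq> \<M>"
      using w(2) set_take_subset[of j w] set_drop_subset[of j w] by blast+
    have "h w \<le> h (drop j w) * h (take j w)"
      using happ[of "take j w" "drop j w"] by simp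
    also have "\<dots> \<le> m k * m j"
      using hm[OF 1(1)] hm[OF 1(2)] w(1) h0 m0 by (intro mult_mono) auto
    finally show "y \<le> m j * m k"
      using w by (simp add: mult.commute)
  qed
  \<comment> \<open>The definition takes the maximum of the roots, Fekete's lemma the root of the
    maximum. Monotonicity of \<open>root k\<close> identifies the two.\<close>
  have root: "(MAX w\<in>W k. root k (h w)) = root k (m k)" if "k > 0" for k
  proof -
    have "mono (root k)"
      using that by (intro monoI real_root_le_mono) auto
    then have "root k (m k) = Max (root k ` h ` W k)"
      unfolding m_def using finW neW by (intro mono_Max_commute) auto
    then show ?thesis by (simp add: image_image)
  qed
  obtain l where l: "(\<lambda>k. root k (m k)) \<longlonglongrightarrow> l"
    using submultiplicative_root_convergent[of m] m0 mm by (auto simp: convergent_def)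
  have "(\<lambda>k. MAX w\<in>W k. root k (h w)) \<longlonglongrightarrow> l"
    using l by (rule Lim_transform_eventually)
      (rule eventually_mono[OF eventually_gt_at_top root[symmetric]])
  then have "joint_spectral_radius \<M> = l"
    unfolding joint_spectral_radius_def W_def h_def by (rule limI)
  then have "\<forall>\<^sub>F k in sequentially. root k (m k) < b"
    using l assms(3) by (intro order_tendstoD) auto
  then have "\<forall>\<^sub>F k in sequentially. 0 < k \<and> root k (m k) < b"
    using eventually_gt_at_top[of 0] by eventually_elim simp
  then obtain n where "0 < n" "root n (m n) < b"
    by (auto dest: eventually_happens)
  then obtain c where c: "c > 0" "\<And>k. m k \<le> c * b ^ k"
    using submultiplicative_le_geometric[of m n b] m0 mm by metis
  show ?thesis
  proof (rule that[OF c(1)])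
    fix w x assume w: "set w \<subseteq> \<M>"
    have "norm (fold (**) w (mat 1) *v x) \<le> h w * norm x"
      unfolding h_def by (intro onorm matrix_vector_mul_bounded_linear)
    also have "\<dots> \<le> c * b ^ length w * norm x"
      using hm[OF w] c(2)[of "length w"] by (intro mult_right_mono) auto
    finally show "norm (fold (**) w (mat 1) *v x) \<le> c * b ^ length w * norm x" .
  qed
qed

section \<open>The optimal Q-function is a fixed point\<close>

lemma policy_matrix_vector:
  "((P ** policy_matrix \<pi>) *v x) $ sa = (\<Sum>s'\<in>UNIV. P $ sa $ s' * x $ (s', \<pi> s'))"
proof -
  have "(policy_matrix \<pi> *v x) $ s = x $ (s, \<pi> s)" for s
  proof -
    have "(policy_matrix \<pi> *v x) $ s = (\<Sum>sa\<in>UNIV. if sa = (s, \<pi> s) then x $ sa else 0)"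
      unfolding matrix_vector_mult_def policy_matrix_def by (auto intro!: sum.cong simp del: sum.delta sum.delta')
    then show ?thesis by simp
  qed
  then show ?thesis
    by (simp add: matrix_vector_mul_assoc[symmetric]) (simp add: matrix_vector_mult_def)
qed

lemma convex_combination_le:
  fixes p f :: "'s::finite \<Rightarrow> real"
  assumes "\<And>s. 0 \<le> p s" "sum p UNIV = 1" "\<And>s. f s \<le> M"
  shows "(\<Sum>s\<in>UNIV. p s * f s) \<le> M"
proof -
  have "(\<Sum>s\<in>UNIV. p s * f s) \<le> (\<Sum>s\<in>UNIV. p s * M)"
    using assms by (intro sum_mono mult_left_mono) auto
  also have "\<dots> = M"
    using assms by (simp add: sum_distrib_right[symmetric])
  finally show ?thesis .
qed

text \<open>Split the reward at time 0 off the return series, then interchange the remaining series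
  with the finite sum over successor states.\<close>

lemma policy_Q_eq:
  fixes P :: "real ^ 's ^ ('s::finite \<times> 'a::finite)"
  assumes "discounted_mdp P \<gamma>"
  shows "policy_Q P R \<gamma> \<pi> $ sa =
    R $ sa + \<gamma> * (\<Sum>s'\<in>UNIV. P $ sa $ s' * policy_Q P R \<gamma> \<pi> $ (s', \<pi> s'))"
proof -
  have P: "\<And>sa s'. 0 \<le> P $ sa $ s'" "\<And>sa. (\<Sum>s'\<in>UNIV. P $ sa $ s') = 1" "0 < \<gamma>" "\<gamma> < 1"
    using assms by (auto simp: discounted_mdp_def)
  define T where "T k = ((\<lambda>x. (P ** policy_matrix \<pi>) *v x) ^^ k) R" for k
  have T0: "T 0 = R" by (simp add: T_def)
  have TS: "T (Suc k) $ sa = (\<Sum>s'\<in>UNIV. P $ sa $ s' * T k $ (s', \<pi> s'))" for k sa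
    by (simp add: T_def policy_matrix_vector)
  \<comment> \<open>Averaging over successors preserves this bound, so the return series is
    dominated by a geometric one.\<close>
  define C where "C = (MAX sa. \<bar>R $ sa\<bar>)"
  have bd: "\<bar>T k $ sa\<bar> \<le> C" for k sa
  proof (induction k arbitrary: sa)
    case 0
    show ?case unfolding T0 C_def by (intro Max_ge) auto
  next
    case (Suc k)
    have "\<bar>T (Suc k) $ sa\<bar> \<le> (\<Sum>s'\<in>UNIV. \<bar>P $ sa $ s' * T k $ (s', \<pi> s')\<bar>)"
      unfolding TS by (rule sum_abs)
    also have "\<dots> = (\<Sum>s'\<in>UNIV. P $ sa $ s' * \<bar>T k $ (s', \<pi> s')\<bar>)"
      using P by (simp add: abs_mult)
    also have "\<dots> \<le> C"
      using P Suc by (intro convex_combination_le) auto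
    finally show ?case .
  qed
  have sm: "summable (\<lambda>k. \<gamma> ^ k * T k $ sa)" for sa
  proof (rule summable_comparison_test'[of "\<lambda>k. \<gamma> ^ k * C"])
    show "summable (\<lambda>k. \<gamma> ^ k * C)"
      using P by (intro summable_mult2 summable_geometric) auto
    show "norm (\<gamma> ^ k * T k $ sa) \<le> \<gamma> ^ k * C" for k
      using P bd by (auto simp: abs_mult intro!: mult_left_mono)
  qed
  have Q: "policy_Q P R \<gamma> \<pi> $ sa = (\<Sum>k. \<gamma> ^ k * T k $ sa)" for sa
    by (simp add: policy_Q_def T_def)
  have "policy_Q P R \<gamma> \<pi> $ sa = R $ sa + (\<Sum>k. \<gamma> ^ Suc k * T (Suc k) $ sa)"
    unfolding Q using suminf_split_head[OF sm[of sa]] by (simp add: T0)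
  also have "(\<Sum>k. \<gamma> ^ Suc k * T (Suc k) $ sa) =
      (\<Sum>k. \<Sum>s'\<in>UNIV. (\<gamma> * P $ sa $ s') * (\<gamma> ^ k * T k $ (s', \<pi> s')))"
    unfolding TS by (simp add: sum_distrib_left ac_simps)
  also have "\<dots> = (\<Sum>s'\<in>UNIV. (\<gamma> * P $ sa $ s') * policy_Q P R \<gamma> \<pi> $ (s', \<pi> s'))"
    unfolding Q by (subst suminf_sum) (auto intro!: summable_mult sm simp: suminf_mult[OF sm])
  finally show ?thesis
    by (simp add: sum_distrib_left ac_simps)
qed

text \<open>A subsolution \<open>D \<le> \<gamma> P D\<close> is nonpositive, since its maximum satisfies \<open>M \<le> \<gamma> M\<close>.\<close>

lemma discounted_subsolution_nonpos:
  fixes P :: "real ^ 's ^ ('s::finite \<times> 'a::finite)" and D :: "'s \<times> 'a \<Rightarrow> real"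
  assumes "discounted_mdp P \<gamma>"
    and sub: "\<And>sa. D sa \<le> \<gamma> * (\<Sum>s'\<in>UNIV. P $ sa $ s' * D (s', \<pi> s'))"
  shows "D sa \<le> 0"
proof -
  have P: "\<And>sa s'. 0 \<le> P $ sa $ s'" "\<And>sa. (\<Sum>s'\<in>UNIV. P $ sa $ s') = 1" "0 < \<gamma>" "\<gamma> < 1"
    using assms by (auto simp: discounted_mdp_def)
  define M where "M = Max (range D)"
  have M: "D sa \<le> M" for sa
    unfolding M_def by (intro Max_ge) auto
  have "M \<in> range D"
    unfolding M_def by (intro Max_in) auto
  then obtain sa0 where "M = D sa0" by auto
  also have "\<dots> \<le> \<gamma> * (\<Sum>s'\<in>UNIV. P $ sa0 $ s' * D (s', \<pi> s'))"
    by (rule sub)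
  also have "\<dots> \<le> \<gamma> * M"
    using P M by (intro mult_left_mono convex_combination_le) auto
  finally have "(1 - \<gamma>) * M \<le> 0"
    by (simp add: algebra_simps)
  then have "M \<le> 0"
    using P by (simp add: mult_le_0_iff)
  with M show ?thesis
    using order_trans by blast
qed

text \<open>Comparison principle: in the difference with \<open>policy_Q_eq\<close> the reward
  cancels, which leaves a homogeneous subsolution.\<close>

lemma policy_Q_upper:
  fixes P :: "real ^ 's ^ ('s::finite \<times> 'a::finite)"
  assumes "discounted_mdp P \<gamma>"
    and "\<And>sa. R $ sa + \<gamma> * (\<Sum>s'\<in>UNIV. P $ sa $ s' * X $ (s', \<pi> s')) \<le> X $ sa"
  shows "policy_Q P R \<gamma> \<pi> $ sa \<le> X $ sa"
proof -
  have "policy_Q P R \<gamma> \<pi> $ sa - X $ sa \<le> 0"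
  proof (rule discounted_subsolution_nonpos[OF assms(1), of "\<lambda>sa. policy_Q P R \<gamma> \<pi> $ sa - X $ sa"])
    show "policy_Q P R \<gamma> \<pi> $ sa - X $ sa \<le>
        \<gamma> * (\<Sum>s'\<in>UNIV. P $ sa $ s' * (policy_Q P R \<gamma> \<pi> $ (s', \<pi> s') - X $ (s', \<pi> s')))" for sa
      using assms(2)[of sa] policy_Q_eq[OF assms(1), of R \<pi> sa]
      by (simp add: algebra_simps sum_subtractf)
  qed
  then show ?thesis by simp
qed

text \<open>The reverse comparison. With \<open>X\<close> the Q-function of one policy and
  \<open>\<pi>\<close> greedy for \<open>X\<close>, it is the policy improvement step.\<close>

lemma policy_Q_lower:
  fixes P :: "real ^ 's ^ ('s::finite \<times> 'a::finite)"
  assumes "discounted_mdp P \<gamma>"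
    and "\<And>sa. X $ sa \<le> R $ sa + \<gamma> * (\<Sum>s'\<in>UNIV. P $ sa $ s' * X $ (s', \<pi> s'))"
  shows "X $ sa \<le> policy_Q P R \<gamma> \<pi> $ sa"
proof -
  have "X $ sa - policy_Q P R \<gamma> \<pi> $ sa \<le> 0"
  proof (rule discounted_subsolution_nonpos[OF assms(1), of "\<lambda>sa. X $ sa - policy_Q P R \<gamma> \<pi> $ sa"])
    show "X $ sa - policy_Q P R \<gamma> \<pi> $ sa \<le>
        \<gamma> * (\<Sum>s'\<in>UNIV. P $ sa $ s' * (X $ (s', \<pi> s') - policy_Q P R \<gamma> \<pi> $ (s', \<pi> s')))" for sa
      using assms(2)[of sa] policy_Q_eq[OF assms(1), of R \<pi> sa]
      by (simp add: algebra_simps sum_subtractf)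
  qed
  then show ?thesis by simp
qed

section \<open>Policy improvement\<close>

lemma greedy_policy_exists:
  fixes Q :: "real ^ ('s::finite \<times> 'a::finite)"
  obtains \<pi> where "\<And>s. Q $ (s, \<pi> s) = (MAX a. Q $ (s, a))"
proof -
  have "\<exists>a. Q $ (s, a) = (MAX a. Q $ (s, a))" for s
  proof -
    have "(MAX a. Q $ (s, a)) \<in> range (\<lambda>a. Q $ (s, a))"
      by (intro Max_in) auto
    then show ?thesis by (metis imageE)
  qed
  then show ?thesis using that by metis
qed

text \<open>
  Policy improvement: a policy maximizing the sum of the entries of its Q-function cannot be
  improved by its greedy policy, so its Q-function is fixed by the Bellman operator.
\<close>

lemma bellman_opt_Q:
  fixes P :: "real ^ 's ^ ('s::finite \<times> 'a::finite)"
  assumes mdp: "discounted_mdp P \<gamma>"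
  shows "bellman P R \<gamma> (opt_Q P R \<gamma>) = opt_Q P R \<gamma>"
proof -
  have P: "\<And>sa s'. 0 \<le> P $ sa $ s'" "0 < \<gamma>"
    using assms by (auto simp: discounted_mdp_def)
  let ?q = "policy_Q P R \<gamma>"
  have mono: "R $ sa + \<gamma> * (\<Sum>s'\<in>UNIV. P $ sa $ s' * f s')
      \<le> R $ sa + \<gamma> * (\<Sum>s'\<in>UNIV. P $ sa $ s' * g s')" if "\<And>s. f s \<le> g s" for f g sa
    using that P by (intro add_left_mono mult_left_mono sum_mono) auto
  have le_max: "X $ (s, a) \<le> (MAX a. X $ (s, a))" for X :: "real ^ ('s \<times> 'a)" and s a
    by (intro Max_ge) auto
  define g where "g \<pi> = (\<Sum>sa\<in>UNIV. ?q \<pi> $ sa)" for \<pi>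
  have "Max (range g) \<in> range g"
    by (intro Max_in) auto
  then obtain \<pi> where "g \<pi> = Max (range g)" by (metis imageE)
  then have best: "g \<pi>' \<le> g \<pi>" for \<pi>'
    by simp
  obtain \<pi>' where \<pi>': "\<And>s. ?q \<pi> $ (s, \<pi>' s) = (MAX a. ?q \<pi> $ (s, a))"
    using greedy_policy_exists by blast
  have improve: "?q \<pi> $ sa \<le> R $ sa + \<gamma> * (\<Sum>s'\<in>UNIV. P $ sa $ s' * ?q \<pi> $ (s', \<pi>' s'))" for sa
    unfolding \<pi>' by (subst policy_Q_eq[OF mdp]) (intro mono le_max)
  have le: "?q \<pi> $ sa \<le> ?q \<pi>' $ sa" for sa
    by (rule policy_Q_lower[OF mdp improve])
  have eq: "?q \<pi> $ sa = ?q \<pi>' $ sa" for sa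
  proof (rule ccontr)
    assume "?q \<pi> $ sa \<noteq> ?q \<pi>' $ sa"
    then have "g \<pi> < g \<pi>'"
      unfolding g_def using le by (intro sum_strict_mono_ex1) (auto intro!: bexI[of _ sa] simp: less_le simp del: split_paired_Ex)
    then show False using best[of \<pi>'] by simp
  qed
  \<comment> \<open>Both policies share one Q-function, and \<open>\<pi>'\<close> is greedy for it,
    so the evaluation equation of \<open>\<pi>'\<close> is the Bellman equation.\<close>
  have fixp: "?q \<pi> $ sa = R $ sa + \<gamma> * (\<Sum>s'\<in>UNIV. P $ sa $ s' * (MAX a. ?q \<pi> $ (s', a)))" for sa
    unfolding \<pi>'[symmetric] unfolding eq by (rule policy_Q_eq[OF mdp])
  \<comment> \<open>A Bellman fixed point is a supersolution for every policy, so
    \<open>\<pi>\<close> attains the maximum in \<open>opt_Q\<close> at all pairs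
    simultaneously.\<close>
  have upper: "?q \<pi>'' $ sa \<le> ?q \<pi> $ sa" for \<pi>'' sa
  proof (rule policy_Q_upper[OF mdp])
    show "R $ sa + \<gamma> * (\<Sum>s'\<in>UNIV. P $ sa $ s' * ?q \<pi> $ (s', \<pi>'' s')) \<le> ?q \<pi> $ sa" for sa
      by (subst (2) fixp) (intro mono le_max)
  qed
  have "opt_Q P R \<gamma> $ sa = ?q \<pi> $ sa" for sa
    unfolding opt_Q_def vec_lambda_beta using upper[of _ sa] by (intro Max_eqI) auto
  then have "opt_Q P R \<gamma> = ?q \<pi>"
    by (simp add: vec_eq_iff)
  then show ?thesis
    by (simp add: vec_eq_iff bellman_def fixp[symmetric])
qed

section \<open>The projected error recursion\<close>

text \<open>Coordinates are moved to the boundary one at a time: along a segment a convex function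
  is bounded by its value at one of the endpoints.\<close>

lemma convex_on_box_le_vertex:
  fixes g :: "real ^ 's::finite \<Rightarrow> real"
  assumes g: "convex_on UNIV g" and v: "\<And>s. lo s \<le> v $ s" "\<And>s. v $ s \<le> hi s"
  obtains w where "\<And>s. w $ s \<in> {lo s, hi s}" "g v \<le> g w"
proof -
  \<comment> \<open>\<open>T\<close> contains all coordinates that may not yet be at an endpoint;
    the claim itself is the case \<open>T = UNIV\<close>.\<close>
  have "\<exists>w. (\<forall>s. w $ s \<in> {lo s, hi s}) \<and> g v \<le> g w"
    if "finite T" "\<And>s. s \<notin> T \<Longrightarrow> v $ s \<in> {lo s, hi s}" "\<And>s. lo s \<le> v $ s \<and> v $ s \<le> hi s" for T v
    using that
  proof (induction T arbitrary: v rule: finite_induct)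
    case empty
    then show ?case by blast
  next
    case (insert t T)
    define upd where "upd x = (\<chi> s. if s = t then x else v $ s)" for x
    have upd: "upd x $ s = (if s = t then x else v $ s)" for x s
      by (simp add: upd_def)
    have step: "\<exists>w. (\<forall>s. w $ s \<in> {lo s, hi s}) \<and> g (upd x) \<le> g w" if "x \<in> {lo t, hi t}" for x
    proof (rule insert.IH)
      show "upd x $ s \<in> {lo s, hi s}" if "s \<notin> T" for s
        using insert.prems(1)[of s] that \<open>x \<in> _\<close> by (auto simp: upd)
      show "lo s \<le> upd x $ s \<and> upd x $ s \<le> hi s" for s
        using insert.prems(2)[of s] \<open>x \<in> _\<close> by (auto simp: upd)
    qed
    have "v $ t \<in> closed_segment (lo t) (hi t)"
      using insert.prems(2)[of t] by (auto simp: closed_segment_eq_real_ivl)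
    then obtain u where u: "0 \<le> u" "u \<le> 1" "v $ t = (1 - u) * lo t + u * hi t"
      by (auto simp: closed_segment_def)
    have "v = (1 - u) *\<^sub>R upd (lo t) + u *\<^sub>R upd (hi t)"
      using u(3) by (auto simp: vec_eq_iff upd algebra_simps)
    then have "g v \<le> (1 - u) * g (upd (lo t)) + u * g (upd (hi t))"
      using convex_onD[OF g u(1,2), of "upd (lo t)" "upd (hi t)"] by simp
    also have "\<dots> \<le> max (g (upd (lo t))) (g (upd (hi t)))"
      using u by (intro convex_bound_le) auto
    finally show ?case
      using step[of "lo t"] step[of "hi t"] by (auto simp: le_max_iff_disj intro: order_trans)
  qed
  from this[of UNIV v] v that show ?thesis by auto
qed

section \<open>Centering and the projected policy matrices\<close>

lemma centering_matrix_vector: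
  fixes x :: "real ^ 'n::finite"
  shows "centering_matrix *v x = x - ((\<Sum>i\<in>UNIV. x $ i) / real CARD('n)) *\<^sub>R 1"
proof -
  have "((\<chi> i j. 1) :: real^'n^'n) *v x = (\<Sum>i\<in>UNIV. x $ i) *\<^sub>R 1"
    by (simp add: vec_eq_iff matrix_vector_mult_def)
  then show ?thesis
    unfolding centering_matrix_def
    by (simp add: matrix_vector_mult_diff_rdistrib scaleR_matrix_vector_assoc[symmetric])
qed

lemma centering_matrix_one: "centering_matrix *v (c *\<^sub>R 1 :: real ^ 'n::finite) = 0"
  by (simp add: centering_matrix_vector)

text \<open>The rows of \<open>P ** policy_matrix \<pi>\<close> sum to 1, so constant vectors are
  mapped to constant vectors, which the outer centering annihilates. Hence centering the argument
  first changes nothing.\<close>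

lemma projected_policy_matrix_centered:
  fixes P :: "real ^ 's ^ ('s::finite \<times> 'a::finite)" and D :: "real ^ ('s \<times> 'a)"
  assumes "discounted_mdp P \<gamma>"
  shows "projected_policy_matrix P \<gamma> \<pi> *v (centering_matrix *v D) =
    centering_matrix *v ((\<gamma> *\<^sub>R (P ** policy_matrix \<pi>)) *v D)"
proof -
  define A where "A = \<gamma> *\<^sub>R (P ** policy_matrix \<pi>)"
  define d where "d = (\<Sum>i\<in>UNIV. D $ i) / real CARD('s \<times> 'a)"
  have CD: "centering_matrix *v D = D - d *\<^sub>R 1"
    unfolding d_def by (rule centering_matrix_vector)
  have CC: "centering_matrix *v (centering_matrix *v D) = centering_matrix *v D"
    by (subst CD) (simp add: matrix_vector_mult_diff_distrib centering_matrix_one)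
  have "A *v (d *\<^sub>R 1) = (\<gamma> * d) *\<^sub>R 1"
    using assms
    by (simp add: A_def vec_eq_iff scaleR_matrix_vector_assoc[symmetric] policy_matrix_vector
        discounted_mdp_def sum_distrib_right[symmetric])
  then have "centering_matrix *v (A *v (centering_matrix *v D)) = centering_matrix *v (A *v D)"
    unfolding CD by (simp add: matrix_vector_mult_diff_distrib centering_matrix_one)
  then show ?thesis
    unfolding projected_policy_matrix_def A_def[symmetric]
    by (simp add: matrix_vector_mul_assoc[symmetric] CC)
qed

text \<open>
  The difference of the maxima of \<open>Q\<close> and \<open>Q\<^sup>*\<close> lies statewise between the entries of \<open>Q - Q\<^sup>*\<close>
  selected by the greedy policies of \<open>Q\<^sup>*\<close> and of \<open>Q\<close>. The vertices of the resulting box come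
  from deterministic policies, and the norm below is convex on it.
\<close>

lemma bellman_error_le_policy:
  fixes P :: "real ^ 's ^ ('s::finite \<times> 'a::finite)" and B :: "real ^ ('s \<times> 'a) ^ 'm::finite"
  assumes mdp: "discounted_mdp P \<gamma>"
  obtains \<pi> where
    "norm (B *v (centering_matrix *v (bellman P R \<gamma> Q - bellman P R \<gamma> Q')))
      \<le> norm (B *v (projected_policy_matrix P \<gamma> \<pi> *v (centering_matrix *v (Q - Q'))))"
proof -
  obtain \<pi>1 where \<pi>1: "\<And>s. Q' $ (s, \<pi>1 s) = (MAX a. Q' $ (s, a))"
    using greedy_policy_exists by blast
  obtain \<pi>2 where \<pi>2: "\<And>s. Q $ (s, \<pi>2 s) = (MAX a. Q $ (s, a))"
    using greedy_policy_exists by blast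
  have le_max: "X $ (s, a) \<le> (MAX a. X $ (s, a))" for X :: "real ^ ('s \<times> 'a)" and s a
    by (intro Max_ge) auto
  define v :: "real ^ 's" where "v = (\<chi> s. (MAX a. Q $ (s, a)) - (MAX a. Q' $ (s, a)))"
  \<comment> \<open>Rewards cancel in the difference of the two Bellman images, so the left-hand
    norm is that of a linear image of \<open>v\<close>.\<close>
  define M where "M = B ** (centering_matrix ** (\<gamma> *\<^sub>R P))"
  define D where "D = Q - Q'"
  have cvx: "convex_on UNIV (\<lambda>v. norm (M *v v))"
  proof (rule convex_onI)
    fix t :: real and x y assume t: "0 < t" "t < 1"
    have "M *v ((1 - t) *\<^sub>R x + t *\<^sub>R y) = (1 - t) *\<^sub>R (M *v x) + t *\<^sub>R (M *v y)"
      by (simp add: matrix_vector_right_distrib matrix_vector_mult_scaleR)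
    also have "norm \<dots> \<le> norm ((1 - t) *\<^sub>R (M *v x)) + norm (t *\<^sub>R (M *v y))"
      by (rule norm_triangle_ineq)
    finally show "norm (M *v ((1 - t) *\<^sub>R x + t *\<^sub>R y)) \<le> (1 - t) * norm (M *v x) + t * norm (M *v y)"
      using t by simp
  qed simp
  have "D $ (s, \<pi>1 s) \<le> v $ s" "v $ s \<le> D $ (s, \<pi>2 s)" for s
    using le_max[of Q s "\<pi>1 s"] le_max[of Q' s "\<pi>2 s"] by (simp_all add: v_def D_def \<pi>1 \<pi>2)
  then obtain w where w: "\<And>s. w $ s \<in> {D $ (s, \<pi>1 s), D $ (s, \<pi>2 s)}"
      "norm (M *v v) \<le> norm (M *v w)"
    using convex_on_box_le_vertex[OF cvx, of "\<lambda>s. D $ (s, \<pi>1 s)" v "\<lambda>s. D $ (s, \<pi>2 s)"] by blast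
  \<comment> \<open>The resulting policy may mix \<open>\<pi>1\<close> and \<open>\<pi>2\<close>,
    choosing separately in each state.\<close>
  have "\<exists>a. w $ s = D $ (s, a)" for s
    using w(1)[of s] by blast
  then obtain \<pi> where \<pi>: "\<And>s. w $ s = D $ (s, \<pi> s)"
    by metis
  have "bellman P R \<gamma> Q - bellman P R \<gamma> Q' = (\<gamma> *\<^sub>R P) *v v"
    by (simp add: vec_eq_iff bellman_def v_def scaleR_matrix_vector_assoc[symmetric])
      (simp add: matrix_vector_mult_def right_diff_distrib sum_subtractf)
  then have 1: "B *v (centering_matrix *v (bellman P R \<gamma> Q - bellman P R \<gamma> Q')) = M *v v"
    by (simp add: M_def matrix_vector_mul_assoc matrix_mul_assoc)
  have "(\<gamma> *\<^sub>R (P ** policy_matrix \<pi>)) *v D = (\<gamma> *\<^sub>R P) *v w"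
    by (simp add: vec_eq_iff scaleR_matrix_vector_assoc[symmetric] policy_matrix_vector)
      (simp add: matrix_vector_mult_def \<pi>)
  then have 2: "B *v (projected_policy_matrix P \<gamma> \<pi> *v (centering_matrix *v D)) = M *v w"
    by (simp add: projected_policy_matrix_centered[OF mdp] M_def matrix_vector_mul_assoc[symmetric])
  show ?thesis
    using that[of \<pi>] w(2) 1 2 unfolding D_def by simp
qed

text \<open>The policy chosen for an iteration depends on the matrices applied after it. The
  induction therefore peels off the last iteration and absorbs its matrix into the arbitrary left
  factor \<open>B\<close>, building the word from its end.\<close>

lemma q_iter_error_le_word:
  fixes P :: "real ^ 's ^ ('s::finite \<times> 'a::finite)" and B :: "real ^ ('s \<times> 'a) ^ 'm::finite"
  assumes mdp: "discounted_mdp P \<gamma>"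
  shows "\<exists>w. length w = k \<and> set w \<subseteq> range (projected_policy_matrix P \<gamma>) \<and>
    norm (B *v (centering_matrix *v (q_iter P R \<gamma> Q0 k - opt_Q P R \<gamma>)))
      \<le> norm (B *v (fold (**) w (mat 1) *v (centering_matrix *v (Q0 - opt_Q P R \<gamma>))))"
proof (induction k arbitrary: B)
  case 0
  then show ?case by (simp add: q_iter_def)
next
  case (Suc k)
  let ?D = "\<lambda>k. centering_matrix *v (q_iter P R \<gamma> Q0 k - opt_Q P R \<gamma>)"
  have "q_iter P R \<gamma> Q0 (Suc k) - opt_Q P R \<gamma> =
      bellman P R \<gamma> (q_iter P R \<gamma> Q0 k) - bellman P R \<gamma> (opt_Q P R \<gamma>)"
    by (simp add: q_iter_def bellman_opt_Q[OF mdp])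
  then obtain \<pi> where \<pi>:
      "norm (B *v ?D (Suc k)) \<le> norm (B *v (projected_policy_matrix P \<gamma> \<pi> *v ?D k))"
    using bellman_error_le_policy[OF mdp] by metis
  obtain w where w: "length w = k" "set w \<subseteq> range (projected_policy_matrix P \<gamma>)"
      "norm ((B ** projected_policy_matrix P \<gamma> \<pi>) *v ?D k) \<le>
       norm ((B ** projected_policy_matrix P \<gamma> \<pi>) *v
         (fold (**) w (mat 1) *v (centering_matrix *v (Q0 - opt_Q P R \<gamma>))))"
    using Suc.IH by blast
  show ?case
    using \<pi> w by (intro exI[of _ "w @ [projected_policy_matrix P \<gamma> \<pi>]"])
      (auto simp: matrix_vector_mul_assoc matrix_mul_assoc)
qed

text \<open>The norm of the centered error is comparable to the distance from
  \<open>opt_line\<close>, so the decay of matrix words carries over to that distance.\<close>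

lemma trajectory_bound_exists:
  fixes P :: "real ^ 's ^ ('s::finite \<times> 'a::finite)"
  assumes mdp: "discounted_mdp P \<gamma>" and \<beta>: "rho_bar P \<gamma> < \<beta>" "0 < \<beta>"
  shows "\<exists>c>0. trajectory_bound P R \<gamma> \<beta> c"
proof -
  let ?C = "centering_matrix :: real ^ ('s \<times> 'a) ^ ('s \<times> 'a)"
  let ?q = "opt_Q P R \<gamma>"
  let ?L = "opt_line P R \<gamma>"
  obtain c where c: "c > 0"
    "\<And>w x. set w \<subseteq> range (projected_policy_matrix P \<gamma>) \<Longrightarrow>
      norm (fold (**) w (mat 1) *v x) \<le> c * \<beta> ^ length w * norm x"
    using joint_spectral_radius_bound[of "range (projected_policy_matrix P \<gamma>)" \<beta>] \<beta>(1)
    unfolding rho_bar_def by (metis UNIV_not_empty finite finite_imageI image_is_empty)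
  obtain K where K: "K > 0" "\<And>x. norm (?C *v x) \<le> norm x * K"
    using bounded_linear.pos_bounded[OF matrix_vector_mul_bounded_linear[of ?C]] by auto
  have line: "y \<in> ?L \<longleftrightarrow> (\<exists>t. y = ?q + t *\<^sub>R 1)" for y
    by (auto simp: opt_line_def span_singleton)
  have ne: "?L \<noteq> {}"
    using line by blast
  have upper: "infdist Q ?L \<le> norm (?C *v (Q - ?q))" for Q
  proof -
    \<comment> \<open>Shifting \<open>?q\<close> by the mean error gives a point of the line whose
      difference from \<open>Q\<close> is exactly the centered error.\<close>
    define d where "d = (\<Sum>i\<in>UNIV. (Q - ?q) $ i) / real CARD('s \<times> 'a)"
    have "infdist Q ?L \<le> dist Q (?q + d *\<^sub>R 1)"
      using line by (intro infdist_le) blast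
    also have "\<dots> = norm (?C *v (Q - ?q))"
      unfolding centering_matrix_vector d_def[symmetric] by (simp add: dist_norm algebra_simps)
    finally show ?thesis .
  qed
  have lower: "norm (?C *v (Q - ?q)) \<le> K * infdist Q ?L" for Q
  proof -
    \<comment> \<open>Centering is blind to the position of \<open>y\<close> on the line, so one
      bound serves all \<open>y\<close> and passes to the infimum.\<close>
    have "norm (?C *v (Q - ?q)) / K \<le> dist Q y" if y: "y \<in> ?L" for y
    proof -
      obtain t where t: "y = ?q + t *\<^sub>R 1"
        using y line by blast
      have "Q - y = (Q - ?q) - t *\<^sub>R 1"
        by (simp add: t)
      then have "?C *v (Q - y) = ?C *v (Q - ?q)"
        by (simp only: matrix_vector_mult_diff_distrib centering_matrix_one diff_zero)
      then have "norm (?C *v (Q - ?q)) \<le> dist Q y * K"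
        using K(2)[of "Q - y"] by (simp only: dist_norm)
      then show ?thesis
        using K(1) by (simp only: pos_divide_le_eq)
    qed
    then have "norm (?C *v (Q - ?q)) / K \<le> infdist Q ?L"
      using ne by (auto simp: infdist_def intro!: cINF_greatest)
    then show ?thesis
      using K(1) by (simp add: field_simps)
  qed
  have "infdist (q_iter P R \<gamma> Q0 k) ?L \<le> (c * K) * \<beta> ^ k * infdist Q0 ?L" for Q0 k
  proof -
    obtain w where w: "length w = k" "set w \<subseteq> range (projected_policy_matrix P \<gamma>)"
        "norm (?C *v (q_iter P R \<gamma> Q0 k - ?q)) \<le> norm (fold (**) w (mat 1) *v (?C *v (Q0 - ?q)))"
      using q_iter_error_le_word[OF mdp, of k "mat 1" R Q0] by auto
    have "infdist (q_iter P R \<gamma> Q0 k) ?L \<le> norm (?C *v (q_iter P R \<gamma> Q0 k - ?q))"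
      by (rule upper)
    also have "\<dots> \<le> c * \<beta> ^ k * norm (?C *v (Q0 - ?q))"
      using w(3) c(2)[OF w(2), of "?C *v (Q0 - ?q)"] w(1) by simp
    also have "\<dots> \<le> c * \<beta> ^ k * (K * infdist Q0 ?L)"
      using lower c \<beta> by (intro mult_left_mono) auto
    finally show ?thesis by (simp add: ac_simps)
  qed
  then show ?thesis
    using c(1) K(1) by (auto simp: trajectory_bound_def intro!: exI[of _ "c * K"])
qed

section \<open>Identification of optimal actions\<close>

lemma argmax_actions_nonempty: "argmax_actions Q s \<noteq> {}"
proof -
  obtain \<pi> where "\<And>s. Q $ (s, \<pi> s) = (MAX a. Q $ (s, a))"
    using greedy_policy_exists by blast
  then have "\<pi> s \<in> argmax_actions Q s"
    by (auto simp: argmax_actions_def)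
  then show ?thesis by blast
qed

text \<open>The nonoptimal action \<open>a\<close> itself puts \<open>s\<close> into
  \<open>sep_states\<close>, so \<open>gap\<close> is at most the gap at \<open>s\<close>.\<close>

lemma opt_Q_nonoptimal_le:
  assumes "a \<notin> opt_actions P R \<gamma> s" "b \<in> opt_actions P R \<gamma> s"
  shows "opt_Q P R \<gamma> $ (s, a) \<le> opt_Q P R \<gamma> $ (s, b) - gap P R \<gamma>"
proof -
  have "gap P R \<gamma> \<le> state_gap P R \<gamma> s"
    unfolding gap_def using assms by (intro Min_le) (auto simp: sep_states_def)
  moreover have "opt_V P R \<gamma> s = opt_Q P R \<gamma> $ (s, b)"
    unfolding opt_V_def using assms(2)
    by (intro Max_eqI) (auto simp: opt_actions_def argmax_actions_def)
  moreover have "opt_Q P R \<gamma> $ (s, a) \<le> (MAX a\<in>- opt_actions P R \<gamma> s. opt_Q P R \<gamma> $ (s, a))"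
    using assms(1) by (intro Max_ge) auto
  ultimately show ?thesis
    by (simp add: state_gap_def)
qed

text \<open>The extrema range over finite nonempty sets, so strictness for each single action and
  state survives.\<close>

lemma gap_pos:
  assumes "sep_states P R \<gamma> \<noteq> {}"
  shows "0 < gap P R \<gamma>"
proof -
  have "0 < state_gap P R \<gamma> s" if s: "s \<in> sep_states P R \<gamma>" for s
  proof -
    let ?q = "opt_Q P R \<gamma>"
    obtain b where b: "b \<in> opt_actions P R \<gamma> s"
      using argmax_actions_nonempty[of ?q s] by (auto simp: opt_actions_def)
    have V: "opt_V P R \<gamma> s = ?q $ (s, b)"
      unfolding opt_V_def using b
      by (intro Max_eqI) (auto simp: opt_actions_def argmax_actions_def)
    have "?q $ (s, a) < ?q $ (s, b)" if "a \<in> - opt_actions P R \<gamma> s" for a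
      using that b by (auto simp: opt_actions_def argmax_actions_def not_le intro: less_le_trans)
    then have "(MAX a\<in>- opt_actions P R \<gamma> s. ?q $ (s, a)) < ?q $ (s, b)"
      using s by (subst Max_less_iff) (auto simp: sep_states_def)
    then show ?thesis
      by (simp add: state_gap_def V)
  qed
  then show ?thesis
    unfolding gap_def using assms by (subst Min_gr_iff) auto
qed

lemma greedy_optimal_if_near_opt_line:
  assumes tb: "tie_breaking tb" and near: "infdist Q (opt_line P R \<gamma>) < gap P R \<gamma> / 2"
  shows "greedy tb Q s \<in> opt_actions P R \<gamma> s"
proof (rule ccontr)
  define a where "a = greedy tb Q s"
  let ?q = "opt_Q P R \<gamma>"
  assume "greedy tb Q s \<notin> opt_actions P R \<gamma> s"
  then have a: "a \<notin> opt_actions P R \<gamma> s" by (simp add: a_def)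
  obtain b where b: "b \<in> opt_actions P R \<gamma> s"
    using argmax_actions_nonempty[of ?q s] by (auto simp: opt_actions_def)
  have "a \<in> argmax_actions Q s"
    using tb argmax_actions_nonempty[of Q s] by (simp add: a_def greedy_def tie_breaking_def)
  then have Q: "Q $ (s, b) \<le> Q $ (s, a)"
    by (simp add: argmax_actions_def)
  have "opt_line P R \<gamma> \<noteq> {}"
    using span_zero by (auto simp: opt_line_def)
  then obtain y where y: "y \<in> opt_line P R \<gamma>" "dist Q y < gap P R \<gamma> / 2"
    using near by (simp add: infdist_def cINF_less_iff del: less_divide_eq_numeral1) blast
  then obtain t where t: "y = ?q + t *\<^sub>R 1"
    by (auto simp: opt_line_def span_singleton)
  \<comment> \<open>The shift \<open>t\<close> is the same for all entries and cancels when two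
    actions are compared; the two errors then add up to less than the gap.\<close>
  have coord: "\<bar>Q $ i - ?q $ i - t\<bar> < gap P R \<gamma> / 2" for i
    using component_le_norm_cart[of "Q - y" i] y(2) by (simp add: dist_norm t algebra_simps)
  show False
    using coord[of "(s, a)"] coord[of "(s, b)"] Q opt_Q_nonoptimal_le[OF a b] by linarith
qed

text \<open>Taking logarithms turns the inequality into a strict lower bound on \<open>k\<close>,
  and floor plus one is the first integer strictly above that bound.\<close>

lemma K_id_bound:
  assumes \<beta>: "0 < \<beta>" "\<beta> < 1" and c: "0 < c" and gap: "0 < gap P R \<gamma>"
    and k: "K_id P R \<gamma> \<beta> c Q0 \<le> k"
  shows "c * \<beta> ^ k * infdist Q0 (opt_line P R \<gamma>) < gap P R \<gamma> / 2"
proof -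
  define d where "d = c * infdist Q0 (opt_line P R \<gamma>)"
  define \<Delta> where "\<Delta> = gap P R \<gamma>"
  have "\<beta> ^ k * d < \<Delta> / 2"
  proof (cases "d < \<Delta> / 2")
    case True
    \<comment> \<open>Here the threshold is 0, so every \<open>k\<close> has to be covered.\<close>
    have "\<beta> ^ k * d \<le> d"
      using \<beta> c by (intro mult_left_le_one_le) (auto simp: d_def infdist_nonneg power_le_one)
    with True show ?thesis by simp
  next
    case False
    \<comment> \<open>Positivity of \<open>d\<close> makes the logarithm of
      \<open>2 * d / \<Delta>\<close> meaningful.\<close>
    have pos: "\<Delta> > 0" "d > 0"
      using False gap by (auto simp: \<Delta>_def)
    have lnb: "- ln \<beta> > 0"
      using \<beta> by simp
    have "nat \<lfloor>ln (2 * d / \<Delta>) / (- ln \<beta>)\<rfloor> + 1 \<le> k"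
      using k False by (simp add: K_id_def d_def \<Delta>_def ac_simps)
    then have "ln (2 * d / \<Delta>) / (- ln \<beta>) < real k"
      by linarith
    then have "ln (2 * d / \<Delta>) < real k * (- ln \<beta>)"
      using lnb by (simp only: pos_divide_less_eq)
    then have "ln (2 * d / \<Delta> * \<beta> ^ k) < 0"
      using pos \<beta> by (subst ln_mult_pos) (auto simp: ln_realpow)
    then have "2 * d / \<Delta> * \<beta> ^ k < 1"
      using pos \<beta> by (subst (asm) ln_less_zero_iff) auto
    then show ?thesis
      using pos by (simp add: field_simps)
  qed
  then show ?thesis
    by (simp add: d_def \<Delta>_def ac_simps)
qed

theorem corollary2:
  fixes P :: "real ^ 's ^ ('s::finite \<times> 'a::finite)"
    and R :: "real ^ ('s \<times> 'a)"
    and \<gamma> \<epsilon> :: real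
    and tb :: "'s \<Rightarrow> 'a set \<Rightarrow> 'a"
  assumes "discounted_mdp P \<gamma>"
    and "tie_breaking tb"
    and "sep_states P R \<gamma> \<noteq> {}"
    and "\<epsilon> > 0"
    and "rho_bar P \<gamma> + \<epsilon> \<in> {0<..<1}"
  shows "(\<exists>c>0. trajectory_bound P R \<gamma> (rho_bar P \<gamma> + \<epsilon>) c) \<and>
    (\<forall>c Q0. c > 0 \<and> trajectory_bound P R \<gamma> (rho_bar P \<gamma> + \<epsilon>) c \<longrightarrow>
       (\<forall>k \<ge> K_id P R \<gamma> (rho_bar P \<gamma> + \<epsilon>) c Q0.
          q_iter P R \<gamma> Q0 k \<in> practically_optimal tb P R \<gamma> \<and>
          (\<forall>s. greedy tb (q_iter P R \<gamma> Q0 k) s \<in> opt_actions P R \<gamma> s)))"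
proof -
  define \<beta> where "\<beta> = rho_bar P \<gamma> + \<epsilon>"
  have \<beta>: "rho_bar P \<gamma> < \<beta>" "0 < \<beta>" "\<beta> < 1"
    using assms by (auto simp: \<beta>_def)
  \<comment> \<open>Ranging over all \<open>s\<close>, this is by definition also membership in
    \<open>practically_optimal\<close>.\<close>
  have "greedy tb (q_iter P R \<gamma> Q0 k) s \<in> opt_actions P R \<gamma> s"
    if "c > 0" "trajectory_bound P R \<gamma> \<beta> c" "K_id P R \<gamma> \<beta> c Q0 \<le> k" for c Q0 k s
  proof (rule greedy_optimal_if_near_opt_line[OF assms(2)])
    show "infdist (q_iter P R \<gamma> Q0 k) (opt_line P R \<gamma>) < gap P R \<gamma> / 2"
      using K_id_bound[OF \<beta>(2,3) that(1) gap_pos[OF assms(3)] that(3)] that(2)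
      unfolding trajectory_bound_def by (meson le_less_trans)
  qed
  then show ?thesis
    using trajectory_bound_exists[OF assms(1) \<beta>(1,2)]
    unfolding \<beta>_def[symmetric] practically_optimal_def by blast
qed

end
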